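(* Let $d$ be the $L_0$-metric on the state space $[2]\times[2]$, identified with $\{1,2,3,4\}$ in lexicographic order, i.e. $d_{12}=d_{13}=d_{24}=d_{34}=1$ and $d_{14}=d_{23}=2$. Let $\mathcal{M}=\{\nu\in\Delta_3:\nu_1\nu_4=\nu_2\nu_3\}$ be the $2$-bit independence surface. For $\mu\in\Delta_3$ consider the following cases: (1) $\mu_1\ge\mu_4$, $\sqrt{\mu_1}\ge\mu_1+\mu_2$, $\sqrt{\mu_1}\ge\mu_1+\mu_3$; (2) $\mu_2\ge\mu_3$, $\sqrt{\mu_2}\ge\mu_1+\mu_2$, $\sqrt{\mu_2}\ge\mu_2+\mu_4$; (3) $\mu_3\ge\mu_2$, $\sqrt{\mu_3}\ge\mu_1+\mu_3$, $\sqrt{\mu_3}\ge\mu_3+\mu_4$; (4) $\mu_4\ge\mu_1$, $\sqrt{\mu_4}\ge\mu_2+\mu_4$, $\sqrt{\mu_4}\ge\mu_3+\mu_4$; (5) $\mu_1\ge\mu_4$, $\mu_2\ge\mu_3$, $\mu_1+\mu_2\ge\sqrt{\mu_1}$, $\mu_1+\mu_2\ge\sqrt{\mu_2}$; (6) $\mu_1\ge\mu_4$, $\mu_3\ge\mu_2$, $\mu_1+\mu_3\ge\sqrt{\mu_1}$, $\mu_1+\mu_3\ge\sqrt{\mu_3}$; (7) $\mu_4\ge\mu_1$, $\mu_2\ge\mu_3$, $\mu_2+\mu_4\ge\sqrt{\mu_4}$, $\mu_2+\mu_4\ge\sqrt{\mu_2}$; (8) $\mu_4\ge\mu_1$, $\mu_3\ge\mu_2$,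 $\mu_3+\mu_4\ge\sqrt{\mu_4}$, $\mu_3+\mu_4\ge\sqrt{\mu_3}$. Then the Wasserstein distance from $\mu\in\Delta_3$ to $\mathcal{M}$ is $$W_d(\mu,\mathcal{M})=\begin{cases} 2\sqrt{\mu_1}(1-\sqrt{\mu_1})-\mu_2-\mu_3 & \text{in case (1)},\\ 2\sqrt{\mu_2}(1-\sqrt{\mu_2})-\mu_1-\mu_4 & \text{in case (2)},\\ 2\sqrt{\mu_3}(1-\sqrt{\mu_3})-\mu_1-\mu_4 & \text{in case (3)},\\ 2\sqrt{\mu_4}(1-\sqrt{\mu_4})-\mu_2-\mu_3 & \text{in case (4)},\\ |\mu_1\mu_4-\mu_2\mu_3|/(\mu_1+\mu_2) & \text{in case (5)},\\ |\mu_1\mu_4-\mu_2\mu_3|/(\mu_1+\mu_3) & \text{in case (6)},\\ |\mu_1\mu_4-\mu_2\mu_3|/(\mu_2+\mu_4) & \text{in case (7)},\\ |\mu_1\mu_4-\mu_2\mu_3|/(\mu_3+\mu_4) & \text{in case (8)}. \end{cases}$$ The solution function $\mu\mapsto\nu^*(\mu)=\operatorname{argmin}_{\nu\in\mathcal{M}}W_d(\mu,\nu)$ is given, with the same cases (1)--(8) in order, by $$\nu^*(\mu)=\begin{cases} \bigl(\mu_1,\ \sqrt{\mu_1}-\mu_1,\ \sqrt{\mu_1}-\mu_1,\ -2\sqrt{\mu_1}+\mu_1+1\bigr),\\ \bigl(\sqrt{\mu_2}-\mu_2,\ \mu_2,\ -2\sqrt{\mu_2}+\mu_2+1,\ \sqrt{\mu_2}-\mu_2\bigr),\\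 \bigl(\sqrt{\mu_3}-\mu_3,\ -2\sqrt{\mu_3}+\mu_3+1,\ \mu_3,\ \sqrt{\mu_3}-\mu_3\bigr),\\ \bigl(-2\sqrt{\mu_4}+\mu_4+1,\ \sqrt{\mu_4}-\mu_4,\ \sqrt{\mu_4}-\mu_4,\ \mu_4\bigr),\\ \bigl(\mu_1,\ \mu_2,\ \mu_1(\mu_3+\mu_4)/(\mu_1+\mu_2),\ \mu_2(\mu_3+\mu_4)/(\mu_1+\mu_2)\bigr),\\ \bigl(\mu_1,\ \mu_1(\mu_2+\mu_4)/(\mu_1+\mu_3),\ \mu_3,\ \mu_3(\mu_2+\mu_4)/(\mu_1+\mu_3)\bigr),\\ \bigl(\mu_2(\mu_1+\mu_3)/(\mu_2+\mu_4),\ \mu_2,\ \mu_4(\mu_1+\mu_3)/(\mu_2+\mu_4),\ \mu_4\bigr),\\ \bigl(\mu_3(\mu_1+\mu_2)/(\mu_3+\mu_4),\ \mu_4(\mu_1+\mu_2)/(\mu_3+\mu_4),\ \mu_3,\ \mu_4\bigr). \end{cases}$$ The walls of indecision are the surfaces $$\{\mu\in\Delta_3:\mu_2-\mu_3=0,\ \mu_1+\mu_2\ge\sqrt{\mu_1},\ \mu_1+\mu_3\ge\sqrt{\mu_1}\}$$ and $$\{\mu\in\Delta_3:\mu_1-\mu_4=0,\ \mu_1+\mu_2\ge\sqrt{\mu_2},\ \mu_2+\mu_4\ge\sqrt{\mu_2}\}.$$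
   Context: $\Delta_{n-1}=\{(\nu_1,\dots,\nu_n)\in\mathbb{R}^n_{\ge0}:\sum_i\nu_i=1\}$. For a metric $d=(d_{ij})$ on $[n]=\{1,\dots,n\}$ and $\mu,\nu\in\Delta_{n-1}$, the Wasserstein distance is $$W_d(\mu,\nu)=\max\Bigl\{\sum_{i=1}^n(\mu_i-\nu_i)x_i \;:\; x\in\mathbb{R}^n,\ |x_i-x_j|\le d_{ij}\text{ for all }1\le i<j\le n\Bigr\},$$ and for a compact set $\mathcal{M}\subset\Delta_{n-1}$ one puts $W_d(\mu,\mathcal{M})=\min_{\nu\in\mathcal{M}}W_d(\mu,\nu)$. The solution function (argmin) may be multivalued: at points $\mu$ satisfying the conditions of several cases, its values are the points given by all applicable cases. The walls of indecision are formed by the points $\mu\in\Delta_3$ having more than one optimal solution $\nu\in\mathcal{M}$; they are taken as closed sets, i.e. their union is the closure of the set of $\mu$ for which $\operatorname{argmin}_{\nu\in\mathcal{M}}W_d(\mu,\nu)$ has more than one element. *)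

theory Defs
  imports "HOL-Analysis.Analysis"
begin

definition prob_simplex :: "(real ^ 'n::finite) set" where
  "prob_simplex = {\<nu>. (\<forall>i. 0 \<le> \<nu> $ i) \<and> (\<Sum>i\<in>UNIV. \<nu> $ i) = 1}"

text \<open>Quantifying over all pairs \<open>i, j\<close> instead of \<open>i < j\<close> makes no difference for a metric.\<close>

definition lipschitz_vectors :: "('n \<Rightarrow> 'n \<Rightarrow> real) \<Rightarrow> (real ^ 'n::finite) set" where
  "lipschitz_vectors d = {x. \<forall>i j. \<bar>x $ i - x $ j\<bar> \<le> d i j}"

text \<open>For a metric and two probability vectors this supremum is a maximum, see
  \<open>wasserstein_attained\<close> below.\<close>

definition wasserstein :: "('n \<Rightarrow> 'n \<Rightarrow> real) \<Rightarrow> real ^ 'n::finite \<Rightarrow> real ^ 'n \<Rightarrow> real" where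
  "wasserstein d \<mu> \<nu> = (SUP x\<in>lipschitz_vectors d. \<Sum>i\<in>UNIV. (\<mu> $ i - \<nu> $ i) * x $ i)"

definition wasserstein_setdist ::
    "('n \<Rightarrow> 'n \<Rightarrow> real) \<Rightarrow> real ^ 'n::finite \<Rightarrow> (real ^ 'n) set \<Rightarrow> real" where
  "wasserstein_setdist d \<mu> M = (INF \<nu>\<in>M. wasserstein d \<mu> \<nu>)"

definition wasserstein_argmin ::
    "('n \<Rightarrow> 'n \<Rightarrow> real) \<Rightarrow> real ^ 'n::finite \<Rightarrow> (real ^ 'n) set \<Rightarrow> (real ^ 'n) set" where
  "wasserstein_argmin d \<mu> M = {\<nu>. is_arg_min (wasserstein d \<mu>) (\<lambda>\<nu>. \<nu> \<in> M) \<nu>}"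

definition indecision_walls ::
    "('n \<Rightarrow> 'n \<Rightarrow> real) \<Rightarrow> (real ^ 'n::finite) set \<Rightarrow> (real ^ 'n) set" where
  "indecision_walls d M =
     closure {\<mu> \<in> prob_simplex. \<exists>\<nu>\<in>wasserstein_argmin d \<mu> M. \<exists>\<nu>'\<in>wasserstein_argmin d \<mu> M. \<nu> \<noteq> \<nu>'}"

text \<open>In the numeral type \<open>4\<close> the elements are \<open>1, 2, 3\<close> and \<open>4 = 0\<close>.\<close>

definition bit_state :: "4 \<Rightarrow> nat \<times> nat" where
  "bit_state i = (if i = 1 then (1, 1) else if i = 2 then (1, 2) else if i = 3 then (2, 1) else (2, 2))"

definition L0_metric :: "4 \<Rightarrow> 4 \<Rightarrow> real" where
  "L0_metric i j = of_bool (fst (bit_state i) \<noteq> fst (bit_state j))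
                 + of_bool (snd (bit_state i) \<noteq> snd (bit_state j))"

definition indep_surface :: "(real ^ 4) set" where
  "indep_surface = {\<nu> \<in> prob_simplex. \<nu>$1 * \<nu>$4 = \<nu>$2 * \<nu>$3}"

definition region :: "nat \<Rightarrow> real ^ 4 \<Rightarrow> bool" where
  "region k \<mu> \<longleftrightarrow>
     k = 1 \<and> \<mu>$1 \<ge> \<mu>$4 \<and> sqrt (\<mu>$1) \<ge> \<mu>$1 + \<mu>$2 \<and> sqrt (\<mu>$1) \<ge> \<mu>$1 + \<mu>$3 \<or>
     k = 2 \<and> \<mu>$2 \<ge> \<mu>$3 \<and> sqrt (\<mu>$2) \<ge> \<mu>$1 + \<mu>$2 \<and> sqrt (\<mu>$2) \<ge> \<mu>$2 + \<mu>$4 \<or>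
     k = 3 \<and> \<mu>$3 \<ge> \<mu>$2 \<and> sqrt (\<mu>$3) \<ge> \<mu>$1 + \<mu>$3 \<and> sqrt (\<mu>$3) \<ge> \<mu>$3 + \<mu>$4 \<or>
     k = 4 \<and> \<mu>$4 \<ge> \<mu>$1 \<and> sqrt (\<mu>$4) \<ge> \<mu>$2 + \<mu>$4 \<and> sqrt (\<mu>$4) \<ge> \<mu>$3 + \<mu>$4 \<or>
     k = 5 \<and> \<mu>$1 \<ge> \<mu>$4 \<and> \<mu>$2 \<ge> \<mu>$3 \<and> \<mu>$1 + \<mu>$2 \<ge> sqrt (\<mu>$1) \<and> \<mu>$1 + \<mu>$2 \<ge> sqrt (\<mu>$2) \<or>
     k = 6 \<and> \<mu>$1 \<ge> \<mu>$4 \<and> \<mu>$3 \<ge> \<mu>$2 \<and> \<mu>$1 + \<mu>$3 \<ge> sqrt (\<mu>$1) \<and> \<mu>$1 + \<mu>$3 \<ge> sqrt (\<mu>$3) \<or>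
     k = 7 \<and> \<mu>$4 \<ge> \<mu>$1 \<and> \<mu>$2 \<ge> \<mu>$3 \<and> \<mu>$2 + \<mu>$4 \<ge> sqrt (\<mu>$4) \<and> \<mu>$2 + \<mu>$4 \<ge> sqrt (\<mu>$2) \<or>
     k = 8 \<and> \<mu>$4 \<ge> \<mu>$1 \<and> \<mu>$3 \<ge> \<mu>$2 \<and> \<mu>$3 + \<mu>$4 \<ge> sqrt (\<mu>$4) \<and> \<mu>$3 + \<mu>$4 \<ge> sqrt (\<mu>$3)"

text \<open>The two functions below are only meaningful for \<open>k \<in> {1..8}\<close>; on \<open>prob_simplex\<close> the
  denominators are positive in the region where the formula is used.\<close>

definition region_distance :: "nat \<Rightarrow> real ^ 4 \<Rightarrow> real" where
  "region_distance k \<mu> =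
     [2 * sqrt (\<mu>$1) * (1 - sqrt (\<mu>$1)) - \<mu>$2 - \<mu>$3,
      2 * sqrt (\<mu>$2) * (1 - sqrt (\<mu>$2)) - \<mu>$1 - \<mu>$4,
      2 * sqrt (\<mu>$3) * (1 - sqrt (\<mu>$3)) - \<mu>$1 - \<mu>$4,
      2 * sqrt (\<mu>$4) * (1 - sqrt (\<mu>$4)) - \<mu>$2 - \<mu>$3,
      \<bar>\<mu>$1 * \<mu>$4 - \<mu>$2 * \<mu>$3\<bar> / (\<mu>$1 + \<mu>$2),
      \<bar>\<mu>$1 * \<mu>$4 - \<mu>$2 * \<mu>$3\<bar> / (\<mu>$1 + \<mu>$3),
      \<bar>\<mu>$1 * \<mu>$4 - \<mu>$2 * \<mu>$3\<bar> / (\<mu>$2 + \<mu>$4),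
      \<bar>\<mu>$1 * \<mu>$4 - \<mu>$2 * \<mu>$3\<bar> / (\<mu>$3 + \<mu>$4)] ! (k - 1)"

definition region_solution :: "nat \<Rightarrow> real ^ 4 \<Rightarrow> real ^ 4" where
  "region_solution k \<mu> = vector (
     [[\<mu>$1, sqrt (\<mu>$1) - \<mu>$1, sqrt (\<mu>$1) - \<mu>$1, - 2 * sqrt (\<mu>$1) + \<mu>$1 + 1],
      [sqrt (\<mu>$2) - \<mu>$2, \<mu>$2, - 2 * sqrt (\<mu>$2) + \<mu>$2 + 1, sqrt (\<mu>$2) - \<mu>$2],
      [sqrt (\<mu>$3) - \<mu>$3, - 2 * sqrt (\<mu>$3) + \<mu>$3 + 1, \<mu>$3, sqrt (\<mu>$3) - \<mu>$3],
      [- 2 * sqrt (\<mu>$4) + \<mu>$4 + 1, sqrt (\<mu>$4) - \<mu>$4, sqrt (\<mu>$4) - \<mu>$4, \<mu>$4],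
      [\<mu>$1, \<mu>$2, \<mu>$1 * (\<mu>$3 + \<mu>$4) / (\<mu>$1 + \<mu>$2), \<mu>$2 * (\<mu>$3 + \<mu>$4) / (\<mu>$1 + \<mu>$2)],
      [\<mu>$1, \<mu>$1 * (\<mu>$2 + \<mu>$4) / (\<mu>$1 + \<mu>$3), \<mu>$3, \<mu>$3 * (\<mu>$2 + \<mu>$4) / (\<mu>$1 + \<mu>$3)],
      [\<mu>$2 * (\<mu>$1 + \<mu>$3) / (\<mu>$2 + \<mu>$4), \<mu>$2, \<mu>$4 * (\<mu>$1 + \<mu>$3) / (\<mu>$2 + \<mu>$4), \<mu>$4],
      [\<mu>$3 * (\<mu>$1 + \<mu>$2) / (\<mu>$3 + \<mu>$4), \<mu>$4 * (\<mu>$1 + \<mu>$2) / (\<mu>$3 + \<mu>$4), \<mu>$3, \<mu>$4]] ! (k - 1))"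

lemma L0_metric_values:
  "L0_metric 1 2 = 1" "L0_metric 1 3 = 1" "L0_metric 2 4 = 1" "L0_metric 3 4 = 1"
  "L0_metric 1 4 = 2" "L0_metric 2 3 = 2"
  by (simp_all add: L0_metric_def bit_state_def)

lemma L0_metric_is_metric: "Metric_space UNIV L0_metric"
proof
  fix x y z :: 4
  show "0 \<le> L0_metric x y" by (simp add: L0_metric_def)
  show "L0_metric x y = L0_metric y x" by (auto simp: L0_metric_def)
  show "L0_metric x z \<le> L0_metric x y + L0_metric y z" by (simp add: L0_metric_def of_bool_def)
  have "\<forall>x y. L0_metric x y = 0 \<longleftrightarrow> x = y"
    unfolding forall_4 by (simp add: L0_metric_def bit_state_def)
  then show "L0_metric x y = 0 \<longleftrightarrow> x = y" by blast
qed

lemma wasserstein_attained: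
  fixes d :: "'n::finite \<Rightarrow> 'n \<Rightarrow> real" and \<mu> \<nu> :: "real ^ 'n"
  assumes d: "Metric_space UNIV d" and "\<mu> \<in> prob_simplex" "\<nu> \<in> prob_simplex"
  shows "\<exists>x\<in>lipschitz_vectors d. wasserstein d \<mu> \<nu> = (\<Sum>i\<in>UNIV. (\<mu> $ i - \<nu> $ i) * x $ i)
           \<and> (\<forall>y\<in>lipschitz_vectors d. (\<Sum>i\<in>UNIV. (\<mu> $ i - \<nu> $ i) * y $ i) \<le> wasserstein d \<mu> \<nu>)"
proof -
  interpret Metric_space UNIV d by (rule d)
  define f where "f = (\<lambda>x :: real ^ 'n. \<Sum>i\<in>UNIV. (\<mu> $ i - \<nu> $ i) * x $ i)"
  define a :: 'n where "a = undefined"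
  define K where "K = {x \<in> lipschitz_vectors d. x $ a = 0}"
  have "closed K"
  proof -
    have "K = (\<Inter>i. \<Inter>j. {x. \<bar>x $ i - x $ j\<bar> \<le> d i j}) \<inter> {x. x $ a = 0}"
      by (auto simp: K_def lipschitz_vectors_def)
    also have "closed \<dots>"
      by (intro closed_Int closed_INT ballI closed_Collect_le closed_Collect_eq continuous_intros)
    finally show ?thesis .
  qed
  moreover have "bounded K"
  proof (rule bounded_subset[OF bounded_cbox])
    show "K \<subseteq> cbox (\<chi> i. - d i a) (\<chi> i. d i a)"
    proof
      fix x assume x: "x \<in> K"
      have "\<bar>x $ i\<bar> \<le> d i a" for i
      proof -
        have "\<bar>x $ i - x $ a\<bar> \<le> d i a" "x $ a = 0"
          using x unfolding K_def lipschitz_vectors_def by blast+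
        then show ?thesis by simp
      qed
      then show "x \<in> cbox (\<chi> i. - d i a) (\<chi> i. d i a)"
        by (simp add: mem_box_cart abs_le_iff minus_le_iff)
    qed
  qed
  ultimately have "compact K" by (simp add: compact_eq_bounded_closed)
  moreover have "0 \<in> K" by (simp add: K_def lipschitz_vectors_def)
  moreover have "continuous_on K f" unfolding f_def by (intro continuous_intros)
  ultimately obtain x where x: "x \<in> K" "\<And>y. y \<in> K \<Longrightarrow> f y \<le> f x"
    using continuous_attains_sup[of K f] by blast
  have max: "f y \<le> f x" if "y \<in> lipschitz_vectors d" for y
  proof -
    define z where "z = (\<chi> i. y $ i - y $ a)"
    have "z \<in> K" using that by (simp add: z_def K_def lipschitz_vectors_def)
    moreover have "f z = f y - y $ a * ((\<Sum>i\<in>UNIV. \<mu> $ i) - (\<Sum>i\<in>UNIV. \<nu> $ i))"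
      by (simp add: f_def z_def algebra_simps sum_subtractf sum.distrib sum_distrib_left)
    ultimately show ?thesis using x(2)[of z] assms(2,3) by (simp add: prob_simplex_def)
  qed
  have xL: "x \<in> lipschitz_vectors d" using x(1) by (simp add: K_def)
  have "wasserstein d \<mu> \<nu> = f x"
    unfolding wasserstein_def f_def[symmetric]
    by (rule cSup_eq_maximum) (use xL max in \<open>auto simp: f_def\<close>)
  then show ?thesis using xL max unfolding f_def by auto
qed

end

theory Submission
  imports Defs
begin

text \<open>In the coordinates \<open>a = \<nu>\<^sub>1 - \<nu>\<^sub>4\<close>, \<open>b = \<nu>\<^sub>2 - \<nu>\<^sub>3\<close>, \<open>c = \<nu>\<^sub>1 + \<nu>\<^sub>4 - \<nu>\<^sub>2 - \<nu>\<^sub>3\<close> the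
  Lipschitz ball of the 4-cycle is an octahedron, so the Wasserstein distance is the sup norm of
  \<open>(\<Delta>a, \<Delta>b, \<Delta>c / 2)\<close>, and the independence surface is the saddle \<open>c = a\<^sup>2 - b\<^sup>2\<close> over the square
  \<open>\<bar>a\<bar> + \<bar>b\<bar> \<le> 1\<close>. For \<open>\<mu>\<^sub>1\<mu>\<^sub>4 \<ge> \<mu>\<^sub>2\<mu>\<^sub>3\<close> the point \<open>\<mu>\<close> lies above the saddle, and among the points at
  distance at most \<open>T\<close> the function \<open>a\<^sup>2 - b\<^sup>2\<close> is largest where \<open>\<bar>a\<bar>\<close> has grown by \<open>T\<close> and \<open>\<bar>b\<bar>\<close> has
  shrunk by \<open>T\<close>, or to 0 if \<open>T\<close> exceeds it. These two possibilities give the cases (5)-(8) and (1)-(4).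
  The minimiser is unique unless \<open>a = 0\<close> at \<open>\<mu>\<close>, where both signs of the new \<open>a\<close> are possible. The
  symmetries exchanging states 1 and 4, and exchanging the pairs (1,4) and (2,3), reduce all
  cases to (1) and (5) above the saddle.\<close>

section \<open>Coordinates on the simplex, and the Wasserstein distance as a norm in them\<close>

definition bias1 :: "real ^ 4 \<Rightarrow> real" where
  "bias1 \<mu> = \<mu>$1 - \<mu>$4"

definition bias2 :: "real ^ 4 \<Rightarrow> real" where
  "bias2 \<mu> = \<mu>$2 - \<mu>$3"

definition parity :: "real ^ 4 \<Rightarrow> real" where
  "parity \<mu> = \<mu>$1 + \<mu>$4 - \<mu>$2 - \<mu>$3"

definition det4 :: "real ^ 4 \<Rightarrow> real" where
  "det4 \<mu> = \<mu>$1 * \<mu>$4 - \<mu>$2 * \<mu>$3"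

lemma vector_4:
  "(vector [x, y, z, w] :: 'a::zero ^ 4) $ 1 = x"
  "(vector [x, y, z, w] :: 'a::zero ^ 4) $ 2 = y"
  "(vector [x, y, z, w] :: 'a::zero ^ 4) $ 3 = z"
  "(vector [x, y, z, w] :: 'a::zero ^ 4) $ 4 = w"
  unfolding vector_def by simp_all

lemma vec4_eq_iff:
  fixes x y :: "'a ^ 4"
  shows "x = y \<longleftrightarrow> x$1 = y$1 \<and> x$2 = y$2 \<and> x$3 = y$3 \<and> x$4 = y$4"
  by (simp add: vec_eq_iff forall_4)

lemma prob_simplex_4:
  fixes \<mu> :: "real ^ 4"
  shows "\<mu> \<in> prob_simplex \<longleftrightarrow> 0 \<le> \<mu>$1 \<and> 0 \<le> \<mu>$2 \<and> 0 \<le> \<mu>$3 \<and> 0 \<le> \<mu>$4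
     \<and> \<mu>$1 + \<mu>$2 + \<mu>$3 + \<mu>$4 = 1"
  by (auto simp: prob_simplex_def forall_4 sum_4)

lemma prob_simplex_coords:
  assumes "\<mu> \<in> prob_simplex"
  shows "\<mu>$1 = (1 + parity \<mu> + 2 * bias1 \<mu>) / 4" "\<mu>$2 = (1 - parity \<mu> + 2 * bias2 \<mu>) / 4"
    "\<mu>$3 = (1 - parity \<mu> - 2 * bias2 \<mu>) / 4" "\<mu>$4 = (1 + parity \<mu> - 2 * bias1 \<mu>) / 4"
  using assms by (auto simp: prob_simplex_4 parity_def bias1_def bias2_def field_simps)

text \<open>Up to the factor 4, \<open>det4\<close> is the height of \<open>\<mu>\<close> above the
  saddle, so its sign tells on which side \<open>\<mu>\<close> lies.\<close>

lemma det4_coords: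
  assumes "\<mu> \<in> prob_simplex"
  shows "4 * det4 \<mu> = parity \<mu> - (bias1 \<mu>)\<^sup>2 + (bias2 \<mu>)\<^sup>2"
  unfolding det4_def prob_simplex_coords[OF assms] by (simp add: power2_eq_square field_simps)

text \<open>The edges of the 4-cycle suffice: the bound 2 for the two diagonals follows by the
  triangle inequality.\<close>

lemma lipschitz_vectors_L0:
  "x \<in> lipschitz_vectors L0_metric \<longleftrightarrow>
     \<bar>x$1 - x$2\<bar> \<le> 1 \<and> \<bar>x$1 - x$3\<bar> \<le> 1 \<and> \<bar>x$2 - x$4\<bar> \<le> 1 \<and> \<bar>x$3 - x$4\<bar> \<le> 1"
  unfolding lipschitz_vectors_def mem_Collect_eq forall_4
  by (simp add: L0_metric_def bit_state_def abs_le_iff) linarith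

text \<open>Hoelder's inequality for the 1-norm and the sup norm on three coordinates.\<close>

lemma octahedron_dual_norm:
  fixes u v w p q r :: real
  assumes "\<bar>u\<bar> + \<bar>v\<bar> + \<bar>w\<bar> \<le> 1"
  shows "u * p + v * q + w * r \<le> max \<bar>p\<bar> (max \<bar>q\<bar> \<bar>r\<bar>)"
proof -
  define m where "m = max \<bar>p\<bar> (max \<bar>q\<bar> \<bar>r\<bar>)"
  have "u * p \<le> \<bar>u\<bar> * m" "v * q \<le> \<bar>v\<bar> * m" "w * r \<le> \<bar>w\<bar> * m"
    by (rule order_trans[OF abs_ge_self], simp add: abs_mult m_def mult_left_mono)+
  then have "u * p + v * q + w * r \<le> (\<bar>u\<bar> + \<bar>v\<bar> + \<bar>w\<bar>) * m"
    by (simp add: distrib_right)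
  also have "\<dots> \<le> 1 * m" using assms by (intro mult_right_mono) (auto simp: m_def max_def)
  finally show ?thesis by (simp add: m_def)
qed

lemma lipschitz_octahedron:
  fixes x y z w :: real
  assumes "\<bar>x - y\<bar> \<le> 1" "\<bar>x - z\<bar> \<le> 1" "\<bar>y - w\<bar> \<le> 1" "\<bar>z - w\<bar> \<le> 1"
  shows "\<bar>(w - x) / 2\<bar> + \<bar>(z - y) / 2\<bar> + \<bar>(y + z - x - w) / 2\<bar> \<le> 1"
proof -
  define p q r where "p = (w - x) / 2" and "q = (z - y) / 2" and "r = (y + z - x - w) / 2"
  \<comment> \<open>Up to sign, the four edge differences are all combinations of \<open>p\<close>,
    \<open>q\<close>, \<open>r\<close> with signs; bounding their absolute values yields the eight
    faces of the octahedron.\<close>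
  have "x - y = q - p - r" "x - z = - p - q - r" "y - w = r - p - q" "z - w = q + r - p"
    by (simp_all add: p_def q_def r_def field_simps)
  then have "\<bar>q - p - r\<bar> \<le> 1" "\<bar>- p - q - r\<bar> \<le> 1" "\<bar>r - p - q\<bar> \<le> 1" "\<bar>q + r - p\<bar> \<le> 1"
    using assms by simp_all
  then have "\<bar>p\<bar> + \<bar>q\<bar> + \<bar>r\<bar> \<le> 1" by linarith
  then show ?thesis by (simp add: p_def q_def r_def)
qed

lemma wasserstein_L0:
  assumes "\<mu> \<in> prob_simplex" "\<nu> \<in> prob_simplex"
  shows "wasserstein L0_metric \<mu> \<nu> =
    max \<bar>bias1 \<nu> - bias1 \<mu>\<bar> (max \<bar>bias2 \<nu> - bias2 \<mu>\<bar> (\<bar>parity \<nu> - parity \<mu>\<bar> / 2))"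
    (is "_ = ?m")
proof -
  define f where "f = (\<lambda>x :: real ^ 4. \<Sum>i\<in>UNIV. (\<mu> $ i - \<nu> $ i) * x $ i)"
  obtain x where x: "x \<in> lipschitz_vectors L0_metric" "wasserstein L0_metric \<mu> \<nu> = f x"
    and max: "\<And>y. y \<in> lipschitz_vectors L0_metric \<Longrightarrow> f y \<le> wasserstein L0_metric \<mu> \<nu>"
    using wasserstein_attained[OF L0_metric_is_metric assms] unfolding f_def by blast
  have f4: "f y = (\<mu>$1 - \<nu>$1) * y$1 + (\<mu>$2 - \<nu>$2) * y$2 + (\<mu>$3 - \<nu>$3) * y$3 + (\<mu>$4 - \<nu>$4) * y$4" for y
    by (simp add: f_def sum_4)
  let ?p = "bias1 \<nu> - bias1 \<mu>" and ?q = "bias2 \<nu> - bias2 \<mu>" and ?r = "parity \<nu> - parity \<mu>"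
  \<comment> \<open>The pairing only sees \<open>y\<close> modulo constant vectors, as both measures
    have mass 1; three octahedral coordinates of \<open>y\<close> remain.\<close>
  have fx: "f y = ((y$4 - y$1) / 2) * ?p + ((y$3 - y$2) / 2) * ?q
      + ((y$2 + y$3 - y$1 - y$4) / 2) * (?r / 2)" for y
    unfolding f4 prob_simplex_coords[OF assms(1)] prob_simplex_coords[OF assms(2)]
    by (simp add: field_simps)
  have "f x \<le> max \<bar>?p\<bar> (max \<bar>?q\<bar> \<bar>?r / 2\<bar>)"
    unfolding fx using x(1)[unfolded lipschitz_vectors_L0]
    by (intro octahedron_dual_norm lipschitz_octahedron) auto
  \<comment> \<open>The test vectors in this and the next two steps are pairs of opposite vertices
    of the octahedron, one pair per axis.\<close>
  moreover have "\<bar>?p\<bar> \<le> f x"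
    using max[of "vector [-1, 0, 0, 1]"] max[of "vector [1, 0, 0, -1]"]
    unfolding fx lipschitz_vectors_L0 vector_4 x(2) by simp
  moreover have "\<bar>?q\<bar> \<le> f x"
    using max[of "vector [0, -1, 1, 0]"] max[of "vector [0, 1, -1, 0]"]
    unfolding fx lipschitz_vectors_L0 vector_4 x(2) by simp
  moreover have "\<bar>?r\<bar> / 2 \<le> f x"
    using max[of "vector [0, 1, 1, 0]"] max[of "vector [1, 0, 0, 1]"]
    unfolding fx lipschitz_vectors_L0 vector_4 x(2) by (simp add: abs_le_iff)
  ultimately show ?thesis unfolding x(2) by (intro order_antisym) auto
qed

section \<open>The independence surface as a graph over the square of biases\<close>

lemma abs_biases_le_1:
  assumes "\<mu> \<in> prob_simplex"
  shows "\<bar>bias1 \<mu>\<bar> + \<bar>bias2 \<mu>\<bar> \<le> 1"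
  using assms by (auto simp: prob_simplex_4 bias1_def bias2_def)

lemma indep_surface_iff:
  "\<nu> \<in> indep_surface \<longleftrightarrow> \<nu> \<in> prob_simplex \<and> parity \<nu> = (bias1 \<nu>)\<^sup>2 - (bias2 \<nu>)\<^sup>2"
  using det4_coords[of \<nu>] by (auto simp: indep_surface_def det4_def)

text \<open>The product measure with marginals \<open>(1 \<plusminus> (a + b)) / 2\<close> and \<open>(1 \<plusminus> (a - b)) / 2\<close>.\<close>

definition surf_point :: "real \<Rightarrow> real \<Rightarrow> real ^ 4" where
  "surf_point a b = vector
     [(1 + a + b) * (1 + a - b) / 4, (1 + a + b) * (1 - a + b) / 4,
      (1 - a - b) * (1 + a - b) / 4, (1 - a - b) * (1 - a + b) / 4]"

lemma biases_surf_point: "bias1 (surf_point a b) = a" "bias2 (surf_point a b) = b"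
  by (simp_all add: bias1_def bias2_def surf_point_def vector_4 field_simps)

text \<open>The four linear factors are twice the marginal probabilities; they are all nonnegative
  exactly on this square.\<close>

lemma surf_point_in_indep_surface:
  assumes "\<bar>a\<bar> + \<bar>b\<bar> \<le> 1"
  shows "surf_point a b \<in> indep_surface"
proof -
  have "0 \<le> 1 + a + b" "0 \<le> 1 + a - b" "0 \<le> 1 - a + b" "0 \<le> 1 - a - b" using assms by auto
  then show ?thesis
    by (simp add: indep_surface_def prob_simplex_4 surf_point_def vector_4) (simp add: field_simps)
qed

text \<open>On the surface the parity is a function of the biases, so these form a global chart with
  inverse \<open>surf_point\<close>.\<close>

lemma surf_point_biases:
  assumes "\<nu> \<in> indep_surface"
  shows "surf_point (bias1 \<nu>) (bias2 \<nu>) = \<nu>"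
proof -
  have "\<nu> \<in> prob_simplex" "parity \<nu> = (bias1 \<nu>)\<^sup>2 - (bias2 \<nu>)\<^sup>2"
    using assms by (auto simp: indep_surface_iff)
  then show ?thesis
    by (simp add: vec4_eq_iff surf_point_def vector_4 prob_simplex_coords)
      (simp add: power2_eq_square field_simps)
qed

lemma indep_surface_eqI:
  assumes "\<nu> \<in> indep_surface" "\<nu>' \<in> indep_surface" "bias1 \<nu> = bias1 \<nu>'" "bias2 \<nu> = bias2 \<nu>'"
  shows "\<nu> = \<nu>'"
  using surf_point_biases[OF assms(1)] surf_point_biases[OF assms(2)] assms(3,4) by metis

section \<open>The radius at which a ball first touches the saddle\<close>

lemma ball_meets_surface:
  fixes a b A B C T :: real
  assumes T: "0 \<le> T" "C - 2 * T = (\<bar>A\<bar> + T)\<^sup>2 - (max 0 (\<bar>B\<bar> - T))\<^sup>2"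
    and ball: "\<bar>a - A\<bar> \<le> T" "\<bar>b - B\<bar> \<le> T" "\<bar>a\<^sup>2 - b\<^sup>2 - C\<bar> / 2 \<le> T"
  shows "\<bar>a\<bar> = \<bar>A\<bar> + T \<and> \<bar>b\<bar> = max 0 (\<bar>B\<bar> - T) \<and> 0 \<le> a * A \<and> 0 \<le> b * B"
proof -
  have le: "\<bar>a\<bar> \<le> \<bar>A\<bar> + T" "max 0 (\<bar>B\<bar> - T) \<le> \<bar>b\<bar>" using ball by auto
  have "a\<^sup>2 \<le> (\<bar>A\<bar> + T)\<^sup>2" using le(1) T(1) by (simp add: abs_le_square_iff[symmetric])
  moreover have "(max 0 (\<bar>B\<bar> - T))\<^sup>2 \<le> b\<^sup>2" using le(2) by (simp add: abs_le_square_iff[symmetric])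
  moreover have "C - 2 * T \<le> a\<^sup>2 - b\<^sup>2" using ball(3) by (simp add: abs_le_iff)
  \<comment> \<open>The ball bounds \<open>a\<^sup>2 - b\<^sup>2\<close> by \<open>C - 2 * T\<close>
    from above through \<open>a\<close> and \<open>b\<close>, and from below through the third
    coordinate, so both monotone estimates are equalities.\<close>
  ultimately have "a\<^sup>2 = (\<bar>A\<bar> + T)\<^sup>2" "b\<^sup>2 = (max 0 (\<bar>B\<bar> - T))\<^sup>2" using T(2) by linarith+
  then have sq: "\<bar>a\<bar>\<^sup>2 = (\<bar>A\<bar> + T)\<^sup>2" "\<bar>b\<bar>\<^sup>2 = (max 0 (\<bar>B\<bar> - T))\<^sup>2" by simp_all
  have eq: "\<bar>a\<bar> = \<bar>A\<bar> + T" "\<bar>b\<bar> = max 0 (\<bar>B\<bar> - T)"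
    using power2_eq_imp_eq[OF sq(1)] power2_eq_imp_eq[OF sq(2)] T(1) by simp_all
  \<comment> \<open>If \<open>a\<close> had the sign opposite to a nonzero \<open>A\<close>, then
    \<open>\<bar>a - A\<bar>\<close> would be \<open>2 * \<bar>A\<bar> + T\<close>, which exceeds
    \<open>T\<close>.\<close>
  moreover have "0 \<le> a * A"
    unfolding zero_le_mult_iff using eq ball(1) by (auto simp: abs_if split: if_splits)
  moreover have "0 \<le> b * B"
    unfolding zero_le_mult_iff using eq ball(2) by (auto simp: abs_if max_def split: if_splits)
  ultimately show ?thesis by blast
qed

text \<open>The first and third coordinates both reach \<open>T\<close> exactly, while the second
  stays within \<open>T\<close>; hence extremal points lie on the boundary of the ball.\<close>

lemma surface_touches_ball:
  fixes a b A B C T :: real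
  assumes T: "0 \<le> T" "C - 2 * T = (\<bar>A\<bar> + T)\<^sup>2 - (max 0 (\<bar>B\<bar> - T))\<^sup>2"
    and "\<bar>a\<bar> = \<bar>A\<bar> + T" "\<bar>b\<bar> = max 0 (\<bar>B\<bar> - T)" "0 \<le> a * A" "0 \<le> b * B"
  shows "max \<bar>a - A\<bar> (max \<bar>b - B\<bar> (\<bar>a\<^sup>2 - b\<^sup>2 - C\<bar> / 2)) = T"
proof -
  have "a\<^sup>2 = (\<bar>A\<bar> + T)\<^sup>2" "b\<^sup>2 = (max 0 (\<bar>B\<bar> - T))\<^sup>2"
    using assms(3,4) by (metis power2_abs)+
  then have "\<bar>a\<^sup>2 - b\<^sup>2 - C\<bar> / 2 = T" using T by simp
  moreover have "\<bar>a - A\<bar> = T"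
    using assms(1,3,5) unfolding zero_le_mult_iff by (auto simp: abs_if split: if_splits)
  moreover have "\<bar>b - B\<bar> \<le> T"
    using assms(1,4,6) unfolding zero_le_mult_iff by (auto simp: abs_if max_def split: if_splits)
  ultimately show ?thesis by simp
qed

text \<open>At radius \<open>T\<close> the ball around \<open>\<mu>\<close> first touches the surface; the equation is
  \<open>c - 2 * T = a\<^sup>2 - b\<^sup>2\<close> at the extremal corner of the ball. It is only meaningful for
  \<open>det4 \<mu> \<ge> 0\<close>.\<close>

definition touching_radius :: "real ^ 4 \<Rightarrow> real \<Rightarrow> bool" where
  "touching_radius \<mu> T \<longleftrightarrow> 0 \<le> T \<and>
     parity \<mu> - 2 * T = (\<bar>bias1 \<mu>\<bar> + T)\<^sup>2 - (max 0 (\<bar>bias2 \<mu>\<bar> - T))\<^sup>2"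

lemma argmin_eqI:
  assumes "\<And>\<nu>. \<nu> \<in> M \<Longrightarrow> f \<nu> \<ge> T" "\<And>\<nu>. \<nu> \<in> M \<Longrightarrow> f \<nu> = T \<longleftrightarrow> P \<nu>" "\<nu>0 \<in> M" "P \<nu>0"
  shows "{\<nu>. is_arg_min f (\<lambda>\<nu>. \<nu> \<in> M) \<nu>} = {\<nu> \<in> M. P \<nu>}" "(INF \<nu>\<in>M. f \<nu>) = (T::real)"
proof -
  have 0: "f \<nu>0 = T" using assms by blast
  show "{\<nu>. is_arg_min f (\<lambda>\<nu>. \<nu> \<in> M) \<nu>} = {\<nu> \<in> M. P \<nu>}"
    unfolding is_arg_min_linorder using assms 0 by (force intro: order_antisym)
  show "(INF \<nu>\<in>M. f \<nu>) = T"
    by (rule cInf_eq_minimum) (use assms 0 in auto)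
qed

text \<open>A surface point within distance \<open>T\<close> is extremal, and extremal points have
  distance exactly \<open>T\<close>. What remains is to exhibit one extremal point whose biases lie
  in the square.\<close>

lemma argmin_touching_radius:
  assumes \<mu>: "\<mu> \<in> prob_simplex" and T: "touching_radius \<mu> T"
  shows "wasserstein_argmin L0_metric \<mu> indep_surface =
      {\<nu> \<in> indep_surface. \<bar>bias1 \<nu>\<bar> = \<bar>bias1 \<mu>\<bar> + T \<and> \<bar>bias2 \<nu>\<bar> = max 0 (\<bar>bias2 \<mu>\<bar> - T)
         \<and> 0 \<le> bias1 \<nu> * bias1 \<mu> \<and> 0 \<le> bias2 \<nu> * bias2 \<mu>}" (is ?A)
    and "wasserstein_setdist L0_metric \<mu> indep_surface = T" (is ?B)
    and "wasserstein_argmin L0_metric \<mu> indep_surface \<noteq> {}"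
proof -
  let ?P = "\<lambda>\<nu>. \<bar>bias1 \<nu>\<bar> = \<bar>bias1 \<mu>\<bar> + T \<and> \<bar>bias2 \<nu>\<bar> = max 0 (\<bar>bias2 \<mu>\<bar> - T)
         \<and> 0 \<le> bias1 \<nu> * bias1 \<mu> \<and> 0 \<le> bias2 \<nu> * bias2 \<mu>"
  note T' = T[unfolded touching_radius_def]
  have W: "wasserstein L0_metric \<mu> \<nu> = max \<bar>bias1 \<nu> - bias1 \<mu>\<bar> (max \<bar>bias2 \<nu> - bias2 \<mu>\<bar>
      (\<bar>(bias1 \<nu>)\<^sup>2 - (bias2 \<nu>)\<^sup>2 - parity \<mu>\<bar> / 2))" if "\<nu> \<in> indep_surface" for \<nu>
    using that \<mu> by (simp add: indep_surface_iff wasserstein_L0)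
  have P: "?P \<nu>" if "\<nu> \<in> indep_surface" "wasserstein L0_metric \<mu> \<nu> \<le> T" for \<nu>
    by (rule ball_meets_surface[of T "parity \<mu>"]) (use T' that in \<open>auto simp: W\<close>)
  have eq: "wasserstein L0_metric \<mu> \<nu> = T" if "\<nu> \<in> indep_surface" "?P \<nu>" for \<nu>
    unfolding W[OF that(1)] by (rule surface_touches_ball) (use T' that(2) in auto)
  \<comment> \<open>The candidate keeps the signs of the biases of \<open>\<mu>\<close>; where
    \<open>bias1 \<mu>\<close> is 0 either sign would do, and plus is taken.\<close>
  define a where "a = (if 0 \<le> bias1 \<mu> then bias1 \<mu> + T else bias1 \<mu> - T)"
  define b where "b = (if 0 \<le> bias2 \<mu> then max 0 (\<bar>bias2 \<mu>\<bar> - T) else - max 0 (\<bar>bias2 \<mu>\<bar> - T))"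
  have le1: "\<bar>bias1 \<mu>\<bar> + T \<le> 1"
  proof (cases "T \<le> \<bar>bias2 \<mu>\<bar>")
    case True
    then show ?thesis using abs_biases_le_1[OF \<mu>] by linarith
  next
    case False
    then have "(1 + \<bar>bias1 \<mu>\<bar> + T)\<^sup>2 = 1 + parity \<mu> + 2 * \<bar>bias1 \<mu>\<bar>"
      using T' by (simp add: power2_eq_square field_simps)
    \<comment> \<open>The left side is four times \<open>\<mu>$1\<close> or \<open>\<mu>$4\<close>,
      whichever is larger.\<close>
    also have "\<dots> \<le> 2\<^sup>2"
      using \<mu> by (simp add: prob_simplex_4 parity_def bias1_def abs_if)
    finally have "1 + \<bar>bias1 \<mu>\<bar> + T \<le> 2" by (rule power2_le_imp_le) simp
    then show ?thesis by simp
  qed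
  then have "\<bar>a\<bar> + \<bar>b\<bar> \<le> 1"
    using T' abs_biases_le_1[OF \<mu>] by (auto simp: a_def b_def)
  then have 0: "surf_point a b \<in> indep_surface" by (rule surf_point_in_indep_surface)
  have P0: "?P (surf_point a b)"
    unfolding biases_surf_point a_def b_def using T' by (auto simp: zero_le_mult_iff)
  have iff: "wasserstein L0_metric \<mu> \<nu> = T \<longleftrightarrow> ?P \<nu>" if "\<nu> \<in> indep_surface" for \<nu>
    using P[OF that] eq[OF that] by fastforce
  have ge: "wasserstein L0_metric \<mu> \<nu> \<ge> T" if "\<nu> \<in> indep_surface" for \<nu>
    using P[OF that] eq[OF that] by fastforce
  show ?A
    unfolding wasserstein_argmin_def
    by (rule argmin_eqI(1)[where T = T and ?\<nu>0.0 = "surf_point a b"]) (use ge iff 0 P0 in auto)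
  then show "wasserstein_argmin L0_metric \<mu> indep_surface \<noteq> {}" using 0 P0 by blast
  show ?B
    unfolding wasserstein_setdist_def
    by (rule argmin_eqI(2)[where P = ?P and ?\<nu>0.0 = "surf_point a b"]) (use ge iff 0 P0 in auto)
qed

lemma touching_radius_interior_iff:
  assumes "\<mu> \<in> prob_simplex" "T \<le> \<bar>bias2 \<mu>\<bar>"
  shows "touching_radius \<mu> T \<longleftrightarrow> 0 \<le> T \<and> T * (1 + \<bar>bias1 \<mu>\<bar> + \<bar>bias2 \<mu>\<bar>) = 2 * det4 \<mu>"
  using assms(2) det4_coords[OF assms(1)] unfolding touching_radius_def
  by (auto simp: power2_eq_square algebra_simps)

text \<open>Once the second square vanishes, the equation is a quadratic, here completed to a
  square. On the simplex its right side is four times the maximum of \<open>\<mu>$1\<close> and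
  \<open>\<mu>$4\<close>, the source of the square roots.\<close>

lemma touching_radius_boundary_iff:
  assumes "\<bar>bias2 \<mu>\<bar> \<le> T"
  shows "touching_radius \<mu> T \<longleftrightarrow> (1 + \<bar>bias1 \<mu>\<bar> + T)\<^sup>2 = 1 + parity \<mu> + 2 * \<bar>bias1 \<mu>\<bar>"
  using assms unfolding touching_radius_def
  by (auto simp: power2_eq_square algebra_simps)

text \<open>The solution of the linear equation works if it is at most
  \<open>\<bar>bias2 \<mu>\<bar>\<close>; otherwise the root of the quadratic is at least
  \<open>\<bar>bias2 \<mu>\<bar>\<close>.\<close>

lemma touching_radius_exists:
  assumes \<mu>: "\<mu> \<in> prob_simplex" and "0 \<le> det4 \<mu>"
  obtains T where "touching_radius \<mu> T"
proof (cases "2 * det4 \<mu> \<le> \<bar>bias2 \<mu>\<bar> * (1 + \<bar>bias1 \<mu>\<bar> + \<bar>bias2 \<mu>\<bar>)")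
  case True
  define s where "s = 1 + \<bar>bias1 \<mu>\<bar> + \<bar>bias2 \<mu>\<bar>"
  define T where "T = 2 * det4 \<mu> / s"
  have "s > 0" by (simp add: s_def)
  then have T: "0 \<le> T" "T \<le> \<bar>bias2 \<mu>\<bar>" "T * s = 2 * det4 \<mu>"
    using assms True by (auto simp: T_def s_def field_simps)
  then show ?thesis using touching_radius_interior_iff[OF \<mu> T(2)] that by (simp add: s_def)
next
  case False
  define R where "R = sqrt (1 + parity \<mu> + 2 * \<bar>bias1 \<mu>\<bar>)"
  define T where "T = R - 1 - \<bar>bias1 \<mu>\<bar>"
  have ge: "1 + parity \<mu> + 2 * \<bar>bias1 \<mu>\<bar> \<ge> (1 + \<bar>bias1 \<mu>\<bar> + \<bar>bias2 \<mu>\<bar>)\<^sup>2"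
    using False det4_coords[OF \<mu>] by (simp add: power2_eq_square algebra_simps)
  then have "R \<ge> 1 + \<bar>bias1 \<mu>\<bar> + \<bar>bias2 \<mu>\<bar>" unfolding R_def by (rule real_le_rsqrt)
  then have T: "\<bar>bias2 \<mu>\<bar> \<le> T" by (simp add: T_def)
  have "(1 + \<bar>bias1 \<mu>\<bar> + T)\<^sup>2 = 1 + parity \<mu> + 2 * \<bar>bias1 \<mu>\<bar>"
    unfolding T_def R_def using order_trans[OF zero_le_power2 ge] by simp
  then show ?thesis using touching_radius_boundary_iff[OF T] that by simp
qed

text \<open>Replacing \<open>T\<close> by 0 inside the squares only lowers their difference. The
  bound shows that a positive radius needs a point strictly above the saddle.\<close>

lemma touching_radius_le_det4:
  assumes "\<mu> \<in> prob_simplex" "touching_radius \<mu> T"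
  shows "T \<le> 2 * det4 \<mu>"
proof -
  have "(max 0 (\<bar>bias2 \<mu>\<bar> - T))\<^sup>2 \<le> (bias2 \<mu>)\<^sup>2"
    using assms(2) by (simp add: touching_radius_def abs_le_square_iff[symmetric])
  moreover have "(\<bar>bias1 \<mu>\<bar> + T)\<^sup>2 \<ge> (bias1 \<mu>)\<^sup>2"
    using assms(2) by (simp add: touching_radius_def abs_le_square_iff[symmetric])
  ultimately show ?thesis
    using assms(2) det4_coords[OF assms(1)] by (simp add: touching_radius_def)
qed

lemma touching_radius_0_imp_det4_0:
  assumes "\<mu> \<in> prob_simplex" "touching_radius \<mu> 0"
  shows "det4 \<mu> = 0"
  using assms(2) det4_coords[OF assms(1)] by (simp add: touching_radius_def)

section \<open>The formulas in regions 1 and 5\<close>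

definition region_correct :: "nat \<Rightarrow> real ^ 4 \<Rightarrow> bool" where
  "region_correct k \<mu> \<longleftrightarrow>
     region_solution k \<mu> \<in> wasserstein_argmin L0_metric \<mu> indep_surface \<and>
     wasserstein_setdist L0_metric \<mu> indep_surface = region_distance k \<mu>"

text \<open>With \<open>r = sqrt (\<mu>$1)\<close>, the formula is the product measure both of whose
  marginals are \<open>(r, 1 - r)\<close>.\<close>

lemma region_solution_1:
  assumes "0 \<le> \<mu>$1"
  shows "region_solution 1 \<mu> = surf_point (2 * sqrt (\<mu>$1) - 1) 0"
proof -
  define r where "r = sqrt (\<mu>$1)"
  have "\<mu>$1 = r * r" using assms by (simp add: r_def)
  then show ?thesis
    unfolding region_solution_def surf_point_def r_def[symmetric]
    by (simp add: vec4_eq_iff vector_4 field_simps)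
qed

text \<open>The formula keeps the first marginal of \<open>\<mu>\<close> and takes as second
  marginal the conditional distribution \<open>(\<mu>$1, \<mu>$2) / (\<mu>$1 + \<mu>$2)\<close>. The
  sum of the biases is unchanged.\<close>

lemma region_solution_5:
  assumes \<mu>: "\<mu> \<in> prob_simplex" and T: "T * (\<mu>$1 + \<mu>$2) = det4 \<mu>" and "0 < \<mu>$1 + \<mu>$2"
  shows "region_solution 5 \<mu> = surf_point (bias1 \<mu> + T) (bias2 \<mu> - T)"
proof -
  define s where "s = \<mu>$1 + \<mu>$2"
  have sum: "\<mu>$4 = 1 - s - \<mu>$3" "\<mu>$2 = s - \<mu>$1"
    using \<mu> by (auto simp: prob_simplex_4 s_def)
  have T: "T = det4 \<mu> / s" and "s > 0" using assms by (auto simp: s_def field_simps)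
  then show ?thesis
    unfolding region_solution_def surf_point_def T
    by (simp add: vec4_eq_iff vector_4 bias1_def bias2_def det4_def sum) (simp add: field_simps)
qed

lemma region_correct_1:
  assumes \<mu>: "\<mu> \<in> prob_simplex" and reg: "region 1 \<mu>"
  shows "region_correct 1 \<mu>"
proof -
  define r where "r = sqrt (\<mu>$1)"
  define T where "T = region_distance 1 \<mu>"
  have s: "0 \<le> \<mu>$1" "\<mu>$1 \<le> 1" "\<mu>$1 + \<mu>$2 + \<mu>$3 + \<mu>$4 = 1" using \<mu> by (auto simp: prob_simplex_4)
  have r: "\<mu>$1 = r * r" "0 \<le> r" "r \<le> 1" using s by (auto simp: r_def)
  have reg': "bias1 \<mu> \<ge> 0" "r \<ge> \<mu>$1 + \<mu>$2" "r \<ge> \<mu>$1 + \<mu>$3"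
    using reg by (auto simp: region_def bias1_def r_def)
  have T: "T = 2 * r - 1 - bias1 \<mu>"
  proof -
    have "T = 2 * r * (1 - r) - \<mu>$2 - \<mu>$3" by (simp add: T_def region_distance_def r_def)
    then show ?thesis using s(3) r(1) unfolding bias1_def by (simp add: algebra_simps)
  qed
  \<comment> \<open>As the total mass is 1, the two square root inequalities of the region together
    say exactly this.\<close>
  have B: "\<bar>bias2 \<mu>\<bar> \<le> T" using reg' s unfolding T bias1_def bias2_def by linarith
  have "touching_radius \<mu> T"
    unfolding touching_radius_boundary_iff[OF B] using reg' s(3) r(1)
    by (simp add: T parity_def bias1_def power2_eq_square)
  note A = argmin_touching_radius[OF \<mu> this]
  have "surf_point (2 * r - 1) 0 \<in> indep_surface"
    using r by (intro surf_point_in_indep_surface) auto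
  then show ?thesis
    unfolding region_correct_def A(1,2) region_solution_1[OF s(1)] r_def[symmetric] T_def[symmetric]
    using reg' B T r by (auto simp: biases_surf_point intro: mult_nonneg_nonneg)
qed

lemma region_correct_5_pos:
  assumes \<mu>: "\<mu> \<in> prob_simplex" and reg: "region 5 \<mu>" and det: "0 \<le> det4 \<mu>"
  shows "region_correct 5 \<mu>"
proof -
  define T where "T = region_distance 5 \<mu>"
  have s: "0 \<le> \<mu>$1" "0 \<le> \<mu>$2" "\<mu>$1 + \<mu>$2 + \<mu>$3 + \<mu>$4 = 1" using \<mu> by (auto simp: prob_simplex_4)
  have reg': "bias1 \<mu> \<ge> 0" "bias2 \<mu> \<ge> 0" "sqrt (\<mu>$1) \<le> \<mu>$1 + \<mu>$2"
    using reg by (auto simp: region_def bias1_def bias2_def)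
  have pos: "0 < \<mu>$1 + \<mu>$2" using reg' s unfolding bias1_def bias2_def by linarith
  have T: "T * (\<mu>$1 + \<mu>$2) = det4 \<mu>" "0 \<le> T"
    using det pos by (auto simp: T_def region_distance_def det4_def[symmetric])
  have "\<mu>$1 \<le> (\<mu>$1 + \<mu>$2)\<^sup>2" using reg'(3) by (rule sqrt_le_D)
  \<comment> \<open>Multiplying \<open>\<mu>$1\<close> by the total mass makes the identity
    homogeneous; it turns the square root inequality into
    \<open>T \<le> bias2 \<mu>\<close>.\<close>
  also have "(\<mu>$1 + \<mu>$2)\<^sup>2 = \<mu>$1 * (\<mu>$1 + \<mu>$2 + \<mu>$3 + \<mu>$4) + (bias2 \<mu> * (\<mu>$1 + \<mu>$2) - det4 \<mu>)"
    by (simp add: bias2_def det4_def power2_eq_square algebra_simps)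
  finally have "T * (\<mu>$1 + \<mu>$2) \<le> bias2 \<mu> * (\<mu>$1 + \<mu>$2)" using T(1) s(3) by simp
  then have B: "T \<le> \<bar>bias2 \<mu>\<bar>" using pos reg'(2) by simp
  have s2: "1 + \<bar>bias1 \<mu>\<bar> + \<bar>bias2 \<mu>\<bar> = 2 * (\<mu>$1 + \<mu>$2)"
    using reg' s(3) unfolding bias1_def bias2_def by simp
  have "touching_radius \<mu> T"
    unfolding touching_radius_interior_iff[OF \<mu> B] s2 using T by (simp add: algebra_simps)
  note A = argmin_touching_radius[OF \<mu> this]
  have "surf_point (bias1 \<mu> + T) (bias2 \<mu> - T) \<in> indep_surface"
    using reg' B T abs_biases_le_1[OF \<mu>] by (intro surf_point_in_indep_surface) auto
  then show ?thesis
    unfolding region_correct_def A(1,2) region_solution_5[OF \<mu> T(1) pos] T_def[symmetric]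
    using reg' B T by (auto simp: biases_surf_point intro: mult_nonneg_nonneg)
qed

section \<open>Symmetries of the problem and their action on the regions\<close>

text \<open>The formulas are compared only where \<open>region k \<mu>\<close> holds, which also
  confines \<open>k\<close> to the range where the list lookups are meaningful.\<close>

definition region_symmetry :: "(real ^ 4 \<Rightarrow> real ^ 4) \<Rightarrow> (nat \<Rightarrow> nat) \<Rightarrow> bool" where
  "region_symmetry s \<pi> \<longleftrightarrow>
     (\<forall>\<mu>. s (s \<mu>) = \<mu>) \<and>
     (\<forall>\<mu>\<in>prob_simplex. s \<mu> \<in> prob_simplex) \<and>
     (\<forall>\<mu>\<in>indep_surface. s \<mu> \<in> indep_surface) \<and>
     (\<forall>\<mu>\<in>prob_simplex. \<forall>\<nu>\<in>prob_simplex.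
        wasserstein L0_metric (s \<mu>) (s \<nu>) = wasserstein L0_metric \<mu> \<nu>) \<and>
     (\<forall>k \<mu>. region k \<mu> \<longrightarrow> region (\<pi> k) (s \<mu>)
        \<and> region_solution (\<pi> k) (s \<mu>) = s (region_solution k \<mu>)
        \<and> region_distance (\<pi> k) (s \<mu>) = region_distance k \<mu>)"

lemma region_symmetryD:
  assumes "region_symmetry s \<pi>"
  shows "s (s \<mu>) = \<mu>"
    and "\<mu> \<in> prob_simplex \<Longrightarrow> s \<mu> \<in> prob_simplex"
    and "\<mu> \<in> indep_surface \<Longrightarrow> s \<mu> \<in> indep_surface"
    and "\<lbrakk>\<mu> \<in> prob_simplex; \<nu> \<in> prob_simplex\<rbrakk> \<Longrightarrow>
      wasserstein L0_metric (s \<mu>) (s \<nu>) = wasserstein L0_metric \<mu> \<nu>"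
    and "region k \<mu> \<Longrightarrow> region (\<pi> k) (s \<mu>)"
    and "region k \<mu> \<Longrightarrow> region_solution (\<pi> k) (s \<mu>) = s (region_solution k \<mu>)"
    and "region k \<mu> \<Longrightarrow> region_distance (\<pi> k) (s \<mu>) = region_distance k \<mu>"
  using assms unfolding region_symmetry_def by blast+

text \<open>On pairs of bits: exchange the two bits and complement both. This fixes states 2 and 3
  and preserves the side of the saddle.\<close>

definition flip :: "real ^ 4 \<Rightarrow> real ^ 4" where
  "flip \<mu> = vector [\<mu>$4, \<mu>$2, \<mu>$3, \<mu>$1]"

text \<open>Toggles the second bit and thereby interchanges the two sides of the saddle.\<close>

definition swap :: "real ^ 4 \<Rightarrow> real ^ 4" where
  "swap \<mu> = vector [\<mu>$2, \<mu>$1, \<mu>$4, \<mu>$3]"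

definition flip_region :: "nat \<Rightarrow> nat" where
  "flip_region k = [4, 2, 3, 1, 7, 8, 5, 6] ! (k - 1)"

definition swap_region :: "nat \<Rightarrow> nat" where
  "swap_region k = [2, 1, 4, 3, 5, 7, 6, 8] ! (k - 1)"

lemma flip_coords: "bias1 (flip \<mu>) = - bias1 \<mu>" "bias2 (flip \<mu>) = bias2 \<mu>"
  "parity (flip \<mu>) = parity \<mu>" "det4 (flip \<mu>) = det4 \<mu>"
  by (simp_all add: flip_def vector_4 bias1_def bias2_def parity_def det4_def)

lemma swap_coords: "bias1 (swap \<mu>) = bias2 \<mu>" "bias2 (swap \<mu>) = bias1 \<mu>"
  "parity (swap \<mu>) = - parity \<mu>" "det4 (swap \<mu>) = - det4 \<mu>"
  by (simp_all add: swap_def vector_4 bias1_def bias2_def parity_def det4_def)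

lemma region_index: "region k \<mu> \<Longrightarrow> k \<in> {1, 2, 3, 4, 5, 6, 7, 8}"
  by (auto simp: region_def)

lemma region_symmetry_flip: "region_symmetry flip flip_region"
proof -
  have simplex: "flip \<mu> \<in> prob_simplex" if "\<mu> \<in> prob_simplex" for \<mu>
    using that by (simp add: prob_simplex_4 flip_def vector_4)
  have W: "wasserstein L0_metric (flip \<mu>) (flip \<nu>) = wasserstein L0_metric \<mu> \<nu>"
    if "\<mu> \<in> prob_simplex" "\<nu> \<in> prob_simplex" for \<mu> \<nu>
    using that simplex by (simp add: wasserstein_L0 flip_coords abs_minus_commute)
  have "region (flip_region k) (flip \<mu>)
        \<and> region_solution (flip_region k) (flip \<mu>) = flip (region_solution k \<mu>)
        \<and> region_distance (flip_region k) (flip \<mu>) = region_distance k \<mu>"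
    if "region k \<mu>" for k \<mu>
    using region_index[OF that] that
    by (elim insertE emptyE) (simp_all add: flip_region_def region_def region_solution_def
      region_distance_def flip_def vector_4 algebra_simps)
  then show ?thesis
    unfolding region_symmetry_def using simplex W
    by (simp add: indep_surface_iff flip_coords) (simp add: flip_def vec4_eq_iff vector_4)
qed

lemma region_symmetry_swap: "region_symmetry swap swap_region"
proof -
  have simplex: "swap \<mu> \<in> prob_simplex" if "\<mu> \<in> prob_simplex" for \<mu>
    using that by (simp add: prob_simplex_4 swap_def vector_4)
  have W: "wasserstein L0_metric (swap \<mu>) (swap \<nu>) = wasserstein L0_metric \<mu> \<nu>"
    if "\<mu> \<in> prob_simplex" "\<nu> \<in> prob_simplex" for \<mu> \<nu>
    using that simplex by (simp add: wasserstein_L0 swap_coords max.left_commute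
      abs_minus_commute[of "parity \<mu>" "parity \<nu>"])
  have "region (swap_region k) (swap \<mu>)
        \<and> region_solution (swap_region k) (swap \<mu>) = swap (region_solution k \<mu>)
        \<and> region_distance (swap_region k) (swap \<mu>) = region_distance k \<mu>"
    if "region k \<mu>" for k \<mu>
    using region_index[OF that] that
    by (elim insertE emptyE) (simp_all add: swap_region_def region_def region_solution_def
      region_distance_def swap_def vector_4 algebra_simps abs_minus_commute)
  then show ?thesis
    unfolding region_symmetry_def using simplex W
    by (simp add: indep_surface_iff swap_coords) (simp add: swap_def vec4_eq_iff vector_4)
qed

lemma argmin_symmetry:
  assumes s: "region_symmetry s \<pi>" and \<mu>: "\<mu> \<in> prob_simplex"
    and \<nu>: "\<nu> \<in> wasserstein_argmin L0_metric \<mu> indep_surface"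
  shows "s \<nu> \<in> wasserstein_argmin L0_metric (s \<mu>) indep_surface"
proof -
  note D = region_symmetryD[OF s]
  have M: "\<nu>' \<in> prob_simplex" if "\<nu>' \<in> indep_surface" for \<nu>'
    using that by (simp add: indep_surface_iff)
  have opt: "\<nu> \<in> indep_surface"
      "\<And>\<nu>'. \<nu>' \<in> indep_surface \<Longrightarrow> wasserstein L0_metric \<mu> \<nu> \<le> wasserstein L0_metric \<mu> \<nu>'"
    using \<nu> by (auto simp: wasserstein_argmin_def is_arg_min_linorder)
  have "wasserstein L0_metric (s \<mu>) (s \<nu>) \<le> wasserstein L0_metric (s \<mu>) \<nu>'"
    if "\<nu>' \<in> indep_surface" for \<nu>'
  proof -
    have "wasserstein L0_metric (s \<mu>) (s \<nu>) = wasserstein L0_metric \<mu> \<nu>"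
      by (rule D(4)[OF \<mu> M[OF opt(1)]])
    also have "\<dots> \<le> wasserstein L0_metric \<mu> (s \<nu>')"
      by (rule opt(2)[OF D(3)[OF that]])
    also have "\<dots> = wasserstein L0_metric (s \<mu>) \<nu>'"
      using D(4)[OF \<mu> M[OF D(3)[OF that]]] by (simp add: D(1))
    finally show ?thesis .
  qed
  then show ?thesis
    using D(3)[OF opt(1)] by (simp add: wasserstein_argmin_def is_arg_min_linorder)
qed

lemma setdist_symmetry:
  assumes s: "region_symmetry s \<pi>" and \<mu>: "\<mu> \<in> prob_simplex"
  shows "wasserstein_setdist L0_metric (s \<mu>) indep_surface = wasserstein_setdist L0_metric \<mu> indep_surface"
proof -
  note D = region_symmetryD[OF s]
  have im: "s ` indep_surface = indep_surface"
  proof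
    show "indep_surface \<subseteq> s ` indep_surface" using D(1,3) by (metis image_eqI subsetI)
  qed (use D(3) in auto)
  have "wasserstein_setdist L0_metric (s \<mu>) indep_surface =
      (INF \<nu>\<in>indep_surface. wasserstein L0_metric (s \<mu>) (s \<nu>))"
    unfolding wasserstein_setdist_def by (subst im[symmetric]) (simp only: image_image)
  also have "\<dots> = wasserstein_setdist L0_metric \<mu> indep_surface"
    unfolding wasserstein_setdist_def
    by (intro INF_cong refl D(4) \<mu>) (simp add: indep_surface_iff)
  finally show ?thesis .
qed

lemma region_correct_symmetry:
  assumes s: "region_symmetry s \<pi>" and \<mu>: "\<mu> \<in> prob_simplex" and reg: "region k \<mu>"
    and correct: "\<lbrakk>s \<mu> \<in> prob_simplex; region (\<pi> k) (s \<mu>)\<rbrakk> \<Longrightarrow> region_correct (\<pi> k) (s \<mu>)"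
  shows "region_correct k \<mu>"
proof -
  note D = region_symmetryD[OF s]
  have "region_correct (\<pi> k) (s \<mu>)" by (rule correct[OF D(2)[OF \<mu>] D(5)[OF reg]])
  then have "s (region_solution k \<mu>) \<in> wasserstein_argmin L0_metric (s \<mu>) indep_surface"
    and "wasserstein_setdist L0_metric \<mu> indep_surface = region_distance k \<mu>"
    by (simp_all add: region_correct_def D(6)[OF reg] D(7)[OF reg] setdist_symmetry[OF s \<mu>])
  then show ?thesis
    using argmin_symmetry[OF s D(2)[OF \<mu>]] by (fastforce simp: region_correct_def D(1))
qed

text \<open>The symmetries act transitively on the regions 1 to 4 and on the regions 5 to 8, so each
  case is carried to region 1 or 5, possibly through cases already settled.\<close>

lemma region_correct:
  assumes "\<mu> \<in> prob_simplex" "region k \<mu>"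
  shows "region_correct k \<mu>"
proof -
  note flip = region_correct_symmetry[OF region_symmetry_flip]
  note swap = region_correct_symmetry[OF region_symmetry_swap]
  note idx = flip_region_def swap_region_def
  have 2: "region_correct 2 \<mu>" if "\<mu> \<in> prob_simplex" "region 2 \<mu>" for \<mu>
    by (rule swap[OF that]) (simp add: idx region_correct_1[simplified])
  have 4: "region_correct 4 \<mu>" if "\<mu> \<in> prob_simplex" "region 4 \<mu>" for \<mu>
    by (rule flip[OF that]) (simp add: idx region_correct_1[simplified])
  have 3: "region_correct 3 \<mu>" if "\<mu> \<in> prob_simplex" "region 3 \<mu>" for \<mu>
    by (rule swap[OF that]) (simp add: idx 4)
  have 5: "region_correct 5 \<mu>" if "\<mu> \<in> prob_simplex" "region 5 \<mu>" for \<mu>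
  proof (cases "0 \<le> det4 \<mu>")
    case True
    with that show ?thesis by (intro region_correct_5_pos)
  next
    case False
    \<comment> \<open>\<open>swap\<close> maps region 5 to itself but reverses the sign of
      \<open>det4\<close>.\<close>
    with that show ?thesis
      by (intro swap[OF that]) (simp add: idx swap_coords region_correct_5_pos)
  qed
  have 7: "region_correct 7 \<mu>" if "\<mu> \<in> prob_simplex" "region 7 \<mu>" for \<mu>
    by (rule flip[OF that]) (simp add: idx 5)
  have 6: "region_correct 6 \<mu>" if "\<mu> \<in> prob_simplex" "region 6 \<mu>" for \<mu>
    by (rule swap[OF that]) (simp add: idx 7)
  have 8: "region_correct 8 \<mu>" if "\<mu> \<in> prob_simplex" "region 8 \<mu>" for \<mu>
    by (rule flip[OF that]) (simp add: idx 6)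
  consider "k = 1" | "k = 2" | "k = 3" | "k = 4" | "k = 5" | "k = 6" | "k = 7" | "k = 8"
    using region_index[OF assms(2)] by blast
  then show ?thesis
    by cases (use assms region_correct_1 2 3 4 5 6 7 8 in blast)+
qed

section \<open>Every minimiser is given by one of the formulas\<close>

definition region_optimum :: "real ^ 4 \<Rightarrow> real ^ 4 \<Rightarrow> bool" where
  "region_optimum \<mu> \<nu> \<longleftrightarrow> (\<exists>k. region k \<mu> \<and> \<nu> = region_solution k \<mu>)"

lemma region_optimum_symmetry:
  assumes s: "region_symmetry s \<pi>" and "region_optimum (s \<mu>) (s \<nu>)"
  shows "region_optimum \<mu> \<nu>"
proof -
  obtain k where k: "region k (s \<mu>)" "s \<nu> = region_solution k (s \<mu>)"
    using assms(2) by (auto simp: region_optimum_def)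
  note inv = region_symmetryD(1)[OF s]
  have "region (\<pi> k) (s (s \<mu>))"
    "region_solution (\<pi> k) (s (s \<mu>)) = s (region_solution k (s \<mu>))"
    using region_symmetryD(5,6)[OF s] k(1) by blast+
  then show ?thesis
    unfolding region_optimum_def k(2)[symmetric] inv by blast
qed

text \<open>Whether \<open>T\<close> reaches \<open>\<bar>bias2 \<mu>\<bar>\<close> decides between
  regions 1 and 5; the equation for \<open>T\<close> then gives back the inequalities of the
  region.\<close>

lemma argmin_region_optimum_pos:
  assumes \<mu>: "\<mu> \<in> prob_simplex" and \<nu>: "\<nu> \<in> wasserstein_argmin L0_metric \<mu> indep_surface"
    and "0 \<le> det4 \<mu>" "0 \<le> bias1 \<nu>" "0 \<le> bias2 \<nu>"
  shows "region_optimum \<mu> \<nu>"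
proof -
  have s: "0 \<le> \<mu>$1" "0 \<le> \<mu>$2" "\<mu>$1 + \<mu>$2 + \<mu>$3 + \<mu>$4 = 1" using \<mu> by (auto simp: prob_simplex_4)
  obtain T where T: "touching_radius \<mu> T" using touching_radius_exists[OF \<mu> assms(3)] .
  then have "0 \<le> T" by (simp add: touching_radius_def)
  have opt: "\<nu> \<in> indep_surface" "bias1 \<nu> = \<bar>bias1 \<mu>\<bar> + T" "bias2 \<nu> = max 0 (\<bar>bias2 \<mu>\<bar> - T)"
      "0 \<le> bias1 \<nu> * bias1 \<mu>" "0 \<le> bias2 \<nu> * bias2 \<mu>"
    using \<nu> assms(4,5) unfolding argmin_touching_radius(1)[OF \<mu> T] by auto
  have A: "0 \<le> bias1 \<mu>" using opt(2,4) \<open>0 \<le> T\<close> by (auto simp: zero_le_mult_iff)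
  show ?thesis
  proof (cases "\<bar>bias2 \<mu>\<bar> \<le> T")
    case True
    have "(2 * sqrt (\<mu>$1))\<^sup>2 = (1 + bias1 \<mu> + T)\<^sup>2"
      using T A s(1,3) unfolding touching_radius_boundary_iff[OF True]
      by (simp add: power_mult_distrib parity_def bias1_def)
    then have r: "2 * sqrt (\<mu>$1) = 1 + bias1 \<mu> + T"
      by (rule power2_eq_imp_eq) (use A s(1) \<open>0 \<le> T\<close> in auto)
    then have "region 1 \<mu>" using True A s(3) unfolding region_def bias1_def bias2_def by auto
    moreover have "\<nu> = region_solution 1 \<mu>"
      using surf_point_biases[OF opt(1)] region_solution_1[OF s(1)] r A True opt(2,3) by simp
    ultimately show ?thesis unfolding region_optimum_def by blast
  next
    case False
    then have B: "0 < bias2 \<mu>" "T \<le> \<bar>bias2 \<mu>\<bar>" using opt(3,5) \<open>0 \<le> T\<close> by (auto simp: zero_le_mult_iff)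
    have pos: "0 < \<mu>$1 + \<mu>$2" using A B s unfolding bias1_def bias2_def by linarith
    have s2: "1 + \<bar>bias1 \<mu>\<bar> + \<bar>bias2 \<mu>\<bar> = 2 * (\<mu>$1 + \<mu>$2)"
      using A B s(3) unfolding bias1_def bias2_def by simp
    have Ts: "T * (\<mu>$1 + \<mu>$2) = det4 \<mu>"
      using T unfolding touching_radius_interior_iff[OF \<mu> B(2)] s2 by (simp add: algebra_simps)
    have "det4 \<mu> \<le> bias2 \<mu> * (\<mu>$1 + \<mu>$2)"
      unfolding Ts[symmetric] using B pos by (intro mult_right_mono) auto
    moreover have "(\<mu>$1 + \<mu>$2)\<^sup>2 = \<mu>$1 * (\<mu>$1 + \<mu>$2 + \<mu>$3 + \<mu>$4) + (bias2 \<mu> * (\<mu>$1 + \<mu>$2) - det4 \<mu>)"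
      by (simp add: bias2_def det4_def power2_eq_square algebra_simps)
    ultimately have "\<mu>$1 \<le> (\<mu>$1 + \<mu>$2)\<^sup>2" using s(3) by simp
    \<comment> \<open>The mirror image of the preceding identity; here \<open>det4\<close> enters
      with a plus sign, so the bound on \<open>\<mu>$2\<close> follows from the signs alone.\<close>
    moreover have "(\<mu>$1 + \<mu>$2)\<^sup>2 = \<mu>$2 * (\<mu>$1 + \<mu>$2 + \<mu>$3 + \<mu>$4) + (bias1 \<mu> * (\<mu>$1 + \<mu>$2) + det4 \<mu>)"
      by (simp add: bias1_def det4_def power2_eq_square algebra_simps)
    then have "\<mu>$2 \<le> (\<mu>$1 + \<mu>$2)\<^sup>2" using s(3) A pos assms(3) by simp
    ultimately have "region 5 \<mu>"
      using A B pos unfolding region_def bias1_def bias2_def by (auto intro: real_le_lsqrt)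
    moreover have "\<nu> = region_solution 5 \<mu>"
      using surf_point_biases[OF opt(1)] region_solution_5[OF \<mu> Ts pos] A B opt(2,3) by simp
    ultimately show ?thesis unfolding region_optimum_def by blast
  qed
qed

text \<open>The symmetry is chosen by the signs of the biases of the minimiser \<open>\<nu>\<close>,
  since those of \<open>\<mu>\<close> do not determine it when there are several minimisers.\<close>

lemma argmin_region_optimum:
  assumes "\<mu> \<in> prob_simplex" "\<nu> \<in> wasserstein_argmin L0_metric \<mu> indep_surface"
  shows "region_optimum \<mu> \<nu>"
proof -
  note sym = region_optimum_symmetry[OF region_symmetry_flip] region_optimum_symmetry[OF region_symmetry_swap]
  define opt where "opt = (\<lambda>\<mu> \<nu>. \<mu> \<in> prob_simplex \<and> \<nu> \<in> wasserstein_argmin L0_metric \<mu> indep_surface)"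
  have opt: "opt (flip \<mu>) (flip \<nu>)" "opt (swap \<mu>) (swap \<nu>)" if "opt \<mu> \<nu>" for \<mu> \<nu>
    using that argmin_symmetry[OF region_symmetry_flip] argmin_symmetry[OF region_symmetry_swap]
      region_symmetryD(2)[OF region_symmetry_flip] region_symmetryD(2)[OF region_symmetry_swap]
    unfolding opt_def by blast+
  have 1: "region_optimum \<mu> \<nu>" if "opt \<mu> \<nu>" "0 \<le> det4 \<mu>" "0 \<le> bias2 \<nu>" for \<mu> \<nu>
  proof (cases "0 \<le> bias1 \<nu>")
    case True
    with that show ?thesis unfolding opt_def by (blast intro: argmin_region_optimum_pos)
  next
    case False
    with that opt(1)[OF that(1)] show ?thesis
      unfolding opt_def by (intro sym(1)[OF argmin_region_optimum_pos]) (auto simp: flip_coords)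
  qed
  have 2: "region_optimum \<mu> \<nu>" if "opt \<mu> \<nu>" "0 \<le> det4 \<mu>" for \<mu> \<nu>
  proof (cases "0 \<le> bias2 \<nu>")
    case True
    with that show ?thesis by (blast intro: 1)
  next
    case False
    \<comment> \<open>Conjugating \<open>flip\<close> by \<open>swap\<close> exchanges states 2 and
      3: it negates \<open>bias2\<close> and preserves \<open>det4\<close>.\<close>
    have "region_optimum (swap (flip (swap \<mu>))) (swap (flip (swap \<nu>)))"
      using that False by (intro 1 opt) (auto simp: flip_coords swap_coords)
    then show ?thesis by (rule sym(2)[OF sym(1)[OF sym(2)]])
  qed
  have "opt \<mu> \<nu>" using assms by (simp add: opt_def)
  then show ?thesis
    using 2[of \<mu> \<nu>] sym(2)[OF 2[OF opt(2)], of \<mu> \<nu>] by (cases "0 \<le> det4 \<mu>") (simp_all add: swap_coords)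
qed

section \<open>Points with more than one minimiser\<close>

definition ambiguous :: "real ^ 4 \<Rightarrow> bool" where
  "ambiguous \<mu> \<longleftrightarrow> (\<exists>\<nu>\<in>wasserstein_argmin L0_metric \<mu> indep_surface.
     \<exists>\<nu>'\<in>wasserstein_argmin L0_metric \<mu> indep_surface. \<nu> \<noteq> \<nu>')"

lemma eq_if_abs_eq_same_sign:
  fixes u v c :: real
  assumes "\<bar>u\<bar> = \<bar>v\<bar>" "0 \<le> u * c" "0 \<le> v * c" "c \<noteq> 0"
  shows "u = v"
proof (rule ccontr)
  assume ne: "u \<noteq> v"
  then have uv: "u = - v" using assms(1) by linarith
  then have "v * c = 0" using assms(2,3) by simp
  then show False using ne uv assms(4) by simp
qed

text \<open>Extremal points can differ only in the signs of their biases. A zero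
  \<open>bias2 \<mu>\<close> leaves no choice, as the new value is 0 as well; a zero
  \<open>bias1 \<mu>\<close> allows both \<open>T\<close> and \<open>- T\<close>, which differ
  unless \<open>T\<close> is 0.\<close>

lemma ambiguous_iff_pos:
  assumes \<mu>: "\<mu> \<in> prob_simplex" and "0 \<le> det4 \<mu>"
  shows "ambiguous \<mu> \<longleftrightarrow> bias1 \<mu> = 0 \<and> 0 < det4 \<mu>"
proof -
  obtain T where T: "touching_radius \<mu> T" using touching_radius_exists[OF assms] .
  then have "0 \<le> T" by (simp add: touching_radius_def)
  note A = argmin_touching_radius[OF \<mu> T]
  show ?thesis
  proof (intro iffI conjI)
    assume "ambiguous \<mu>"
    then obtain \<nu> \<nu>' where \<nu>: "\<nu> \<in> wasserstein_argmin L0_metric \<mu> indep_surface"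
        "\<nu>' \<in> wasserstein_argmin L0_metric \<mu> indep_surface" "\<nu> \<noteq> \<nu>'"
      by (auto simp: ambiguous_def)
    note opt = \<nu>(1,2)[unfolded A(1) mem_Collect_eq]
    have "bias2 \<nu> = bias2 \<nu>'"
    proof (cases "bias2 \<mu> = 0")
      case True
      then show ?thesis using opt \<open>0 \<le> T\<close> by simp
    next
      case False
      then show ?thesis using opt eq_if_abs_eq_same_sign[of "bias2 \<nu>" "bias2 \<nu>'" "bias2 \<mu>"] by metis
    qed
    then have ne: "bias1 \<nu> \<noteq> bias1 \<nu>'"
      using \<nu>(3) opt indep_surface_eqI[of \<nu> \<nu>'] by blast
    then show A0: "bias1 \<mu> = 0"
      using opt eq_if_abs_eq_same_sign[of "bias1 \<nu>" "bias1 \<nu>'" "bias1 \<mu>"] by metis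
    have "T \<noteq> 0" using ne opt A0 by auto
    then show "0 < det4 \<mu>"
      using \<open>0 \<le> T\<close> touching_radius_le_det4[OF \<mu> T] by simp
  next
    assume *: "bias1 \<mu> = 0 \<and> 0 < det4 \<mu>"
    then have "T \<noteq> 0" using touching_radius_0_imp_det4_0[OF \<mu>] T by auto
    obtain \<nu> where \<nu>: "\<nu> \<in> wasserstein_argmin L0_metric \<mu> indep_surface" using A(3) by blast
    \<comment> \<open>As \<open>flip\<close> fixes \<open>\<mu>\<close>, it maps any minimiser to a
      second one with the opposite \<open>bias1\<close>.\<close>
    have "flip \<mu> = \<mu>" using * by (simp add: flip_def bias1_def vec4_eq_iff vector_4)
    then have "flip \<nu> \<in> wasserstein_argmin L0_metric \<mu> indep_surface"
      using argmin_symmetry[OF region_symmetry_flip \<mu> \<nu>] by simp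
    moreover have "bias1 \<nu> \<noteq> bias1 (flip \<nu>)"
      using \<nu> \<open>T \<noteq> 0\<close> * unfolding A(1) flip_coords by auto
    ultimately show "ambiguous \<mu>" using \<nu> unfolding ambiguous_def by metis
  qed
qed

lemma ambiguous_symmetry:
  assumes s: "region_symmetry s \<pi>" and "\<mu> \<in> prob_simplex" "ambiguous \<mu>"
  shows "ambiguous (s \<mu>)"
proof -
  obtain \<nu> \<nu>' where \<nu>: "\<nu> \<in> wasserstein_argmin L0_metric \<mu> indep_surface"
      "\<nu>' \<in> wasserstein_argmin L0_metric \<mu> indep_surface" "\<nu> \<noteq> \<nu>'"
    using assms(3) by (auto simp: ambiguous_def)
  have "s \<nu> \<noteq> s \<nu>'" using \<nu>(3) region_symmetryD(1)[OF s] by metis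
  then show ?thesis using \<nu>(1,2) argmin_symmetry[OF s assms(2)] unfolding ambiguous_def by blast
qed

lemma ambiguous_iff:
  assumes \<mu>: "\<mu> \<in> prob_simplex"
  shows "ambiguous \<mu> \<longleftrightarrow> bias1 \<mu> = 0 \<and> 0 < det4 \<mu> \<or> bias2 \<mu> = 0 \<and> det4 \<mu> < 0"
proof (cases "0 \<le> det4 \<mu>")
  case True
  then show ?thesis using ambiguous_iff_pos[OF \<mu>] by auto
next
  case False
  have "swap \<mu> \<in> prob_simplex" "swap (swap \<mu>) = \<mu>"
    using \<mu> region_symmetryD(1,2)[OF region_symmetry_swap] by auto
  then have "ambiguous \<mu> \<longleftrightarrow> ambiguous (swap \<mu>)"
    using \<mu> ambiguous_symmetry[OF region_symmetry_swap] by metis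
  then show ?thesis
    using False ambiguous_iff_pos[OF \<open>swap \<mu> \<in> prob_simplex\<close>] by (auto simp: swap_coords)
qed

section \<open>The closure of the ambiguous points and the walls\<close>

lemma closure_if_segment:
  fixes x c :: "'a::real_normed_vector"
  assumes "\<And>t. 0 < t \<Longrightarrow> t < 1 \<Longrightarrow> (1 - t) *\<^sub>R x + t *\<^sub>R c \<in> U"
  shows "x \<in> closure U"
proof (rule Lim_in_closed_set[where F = "at_right (0::real)"])
  have "((\<lambda>t. (1 - t) *\<^sub>R x + t *\<^sub>R c) \<longlongrightarrow> (1 - 0) *\<^sub>R x + 0 *\<^sub>R c) (at_right 0)"
    by (intro tendsto_add tendsto_scaleR tendsto_diff tendsto_const tendsto_ident_at)
  then show "((\<lambda>t. (1 - t) *\<^sub>R x + t *\<^sub>R c) \<longlongrightarrow> x) (at_right 0)" by simp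
  show "eventually (\<lambda>t. (1 - t) *\<^sub>R x + t *\<^sub>R c \<in> closure U) (at_right 0)"
    using eventually_at_right_real[OF zero_less_one]
    by eventually_elim (use assms closure_subset[of U] in auto)
qed auto

lemma closure_ambiguous:
  "closure {\<mu> \<in> prob_simplex. ambiguous \<mu>} =
     {\<mu> \<in> prob_simplex. bias2 \<mu> = 0 \<and> det4 \<mu> \<le> 0} \<union> {\<mu> \<in> prob_simplex. bias1 \<mu> = 0 \<and> 0 \<le> det4 \<mu>}"
    (is "closure ?U = ?W2 \<union> ?W1")
proof
  have "closed (?W2 \<union> ?W1)"
    unfolding prob_simplex_4 bias1_def bias2_def det4_def
    by (intro closed_Un closed_Collect_conj closed_Collect_le closed_Collect_eq continuous_intros)
  moreover have "?U \<subseteq> ?W2 \<union> ?W1" by (auto simp: ambiguous_iff)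
  ultimately show "closure ?U \<subseteq> ?W2 \<union> ?W1" by (rule closure_minimal[rotated])
  show "?W2 \<union> ?W1 \<subseteq> closure ?U"
  proof (rule Un_least; rule subsetI)
    fix \<mu> assume \<mu>: "\<mu> \<in> ?W1"
    show "\<mu> \<in> closure ?U"
    \<comment> \<open>The target of the segment is the uniform measure on states 1 and 4, which has
      \<open>bias1\<close> 0 and lies strictly above the saddle.\<close>
    proof (rule closure_if_segment[where c = "vector [1/2, 0, 0, 1/2]"])
      fix t :: real assume t: "0 < t" "t < 1"
      define x where "x = (1 - t) *\<^sub>R \<mu> + t *\<^sub>R (vector [1/2, 0, 0, 1/2] :: real ^ 4)"
      have x: "x$1 = (1 - t) * \<mu>$1 + t/2" "x$2 = (1 - t) * \<mu>$2" "x$3 = (1 - t) * \<mu>$3" "x$4 = (1 - t) * \<mu>$4 + t/2"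
        by (simp_all add: x_def vector_4)
      have s: "0 \<le> \<mu>$1" "0 \<le> \<mu>$2" "0 \<le> \<mu>$3" "\<mu>$4 = \<mu>$1" "\<mu>$1 + \<mu>$2 + \<mu>$3 + \<mu>$4 = 1" "0 \<le> det4 \<mu>"
        using \<mu> by (auto simp: prob_simplex_4 bias1_def)
      have "x$1 + x$2 + x$3 + x$4 = (1 - t) * (\<mu>$1 + \<mu>$2 + \<mu>$3 + \<mu>$4) + t"
        unfolding x by (simp add: algebra_simps)
      then have "x \<in> prob_simplex" using s t by (simp add: prob_simplex_4 x)
      moreover have "bias1 x = 0" by (simp add: bias1_def x s(4))
      \<comment> \<open>\<open>det4\<close> is a quadratic form: the values at both ends enter with
        squared weights, and the mixed term is nonnegative here.\<close>
      moreover have "det4 x = (1 - t)\<^sup>2 * det4 \<mu> + t * (1 - t) * \<mu>$1 + t\<^sup>2 / 4"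
        by (simp add: det4_def x s(4) power2_eq_square field_simps)
      then have "0 < det4 x" using s t by (simp add: add_nonneg_pos)
      ultimately show "(1 - t) *\<^sub>R \<mu> + t *\<^sub>R vector [1/2, 0, 0, 1/2] \<in> ?U"
        unfolding x_def[symmetric] by (simp add: ambiguous_iff)
    qed
  next
    fix \<mu> assume \<mu>: "\<mu> \<in> ?W2"
    show "\<mu> \<in> closure ?U"
    proof (rule closure_if_segment[where c = "vector [0, 1/2, 1/2, 0]"])
      fix t :: real assume t: "0 < t" "t < 1"
      define x where "x = (1 - t) *\<^sub>R \<mu> + t *\<^sub>R (vector [0, 1/2, 1/2, 0] :: real ^ 4)"
      have x: "x$1 = (1 - t) * \<mu>$1" "x$2 = (1 - t) * \<mu>$2 + t/2" "x$3 = (1 - t) * \<mu>$3 + t/2" "x$4 = (1 - t) * \<mu>$4"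
        by (simp_all add: x_def vector_4)
      have s: "0 \<le> \<mu>$1" "0 \<le> \<mu>$2" "0 \<le> \<mu>$4" "\<mu>$3 = \<mu>$2" "\<mu>$1 + \<mu>$2 + \<mu>$3 + \<mu>$4 = 1" "0 \<le> - det4 \<mu>"
        using \<mu> by (auto simp: prob_simplex_4 bias2_def)
      have "x$1 + x$2 + x$3 + x$4 = (1 - t) * (\<mu>$1 + \<mu>$2 + \<mu>$3 + \<mu>$4) + t"
        unfolding x by (simp add: algebra_simps)
      then have "x \<in> prob_simplex" using s t by (simp add: prob_simplex_4 x)
      moreover have "bias2 x = 0" by (simp add: bias2_def x s(4))
      moreover have "- det4 x = (1 - t)\<^sup>2 * (- det4 \<mu>) + t * (1 - t) * \<mu>$2 + t\<^sup>2 / 4"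
        by (simp add: det4_def x s(4) power2_eq_square field_simps)
      moreover have "0 < (1 - t)\<^sup>2 * (- det4 \<mu>) + t * (1 - t) * \<mu>$2 + t\<^sup>2 / 4"
        using s t by (intro add_nonneg_pos add_nonneg_nonneg mult_nonneg_nonneg) auto
      ultimately show "(1 - t) *\<^sub>R \<mu> + t *\<^sub>R vector [0, 1/2, 1/2, 0] \<in> ?U"
        unfolding x_def[symmetric] by (simp add: ambiguous_iff)
    qed
  qed
qed

lemma sqrt_le_iff_power2:
  assumes "0 \<le> y"
  shows "sqrt x \<le> y \<longleftrightarrow> x \<le> y\<^sup>2"
  using assms by (metis sqrt_le_D real_le_lsqrt)

text \<open>Squaring and multiplying \<open>x\<close> by the total mass 1 makes the condition
  homogeneous. With \<open>y\<close> as the common value of two coordinates, it becomes a condition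
  on the sign of \<open>det4\<close>.\<close>

lemma wall_iff:
  fixes x y z :: real
  assumes "0 \<le> x" "0 \<le> y" "x + 2 * y + z = 1"
  shows "sqrt x \<le> x + y \<longleftrightarrow> x * z \<le> y * y"
proof -
  have "sqrt x \<le> x + y \<longleftrightarrow> x * (x + 2 * y + z) \<le> (x + y)\<^sup>2"
    using assms by (simp add: sqrt_le_iff_power2)
  also have "\<dots> \<longleftrightarrow> x * z \<le> y * y" by (simp add: power2_eq_square algebra_simps)
  finally show ?thesis .
qed

theorem theorem2:
  shows "(\<forall>\<mu>\<in>prob_simplex. \<exists>k. region k \<mu>)
    \<and> (\<forall>\<mu>\<in>prob_simplex. \<forall>k. region k \<mu> \<longrightarrow>
          wasserstein_setdist L0_metric \<mu> indep_surface = region_distance k \<mu>)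
    \<and> (\<forall>\<mu>\<in>prob_simplex.
          wasserstein_argmin L0_metric \<mu> indep_surface = {region_solution k \<mu> | k. region k \<mu>})
    \<and> indecision_walls L0_metric indep_surface =
          {\<mu> \<in> prob_simplex. \<mu>$2 - \<mu>$3 = 0 \<and> \<mu>$1 + \<mu>$2 \<ge> sqrt (\<mu>$1) \<and> \<mu>$1 + \<mu>$3 \<ge> sqrt (\<mu>$1)}
        \<union> {\<mu> \<in> prob_simplex. \<mu>$1 - \<mu>$4 = 0 \<and> \<mu>$1 + \<mu>$2 \<ge> sqrt (\<mu>$2) \<and> \<mu>$2 + \<mu>$4 \<ge> sqrt (\<mu>$2)}"
proof (intro conjI ballI allI impI)
  fix \<mu> :: "real ^ 4" assume \<mu>: "\<mu> \<in> prob_simplex"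
  \<comment> \<open>Existence of a minimiser also shows that the regions cover the simplex, since
    every minimiser comes from some region containing \<open>\<mu>\<close>.\<close>
  have nonempty: "wasserstein_argmin L0_metric \<mu> indep_surface \<noteq> {}"
  proof (cases "0 \<le> det4 \<mu>")
    case True
    then show ?thesis using argmin_touching_radius(3)[OF \<mu>] touching_radius_exists[OF \<mu>] by metis
  next
    case False
    have s: "swap \<mu> \<in> prob_simplex" "swap (swap \<mu>) = \<mu>"
      using \<mu> region_symmetryD(1,2)[OF region_symmetry_swap] by auto
    have "0 \<le> det4 (swap \<mu>)" using False by (simp add: swap_coords)
    then obtain \<nu> where "\<nu> \<in> wasserstein_argmin L0_metric (swap \<mu>) indep_surface"
      using argmin_touching_radius(3)[OF s(1)] touching_radius_exists[OF s(1)] by blast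
    then show ?thesis using argmin_symmetry[OF region_symmetry_swap s(1)] s(2) by fastforce
  qed
  then show "\<exists>k. region k \<mu>"
    using argmin_region_optimum[OF \<mu>] by (auto simp: region_optimum_def)
  show "wasserstein_argmin L0_metric \<mu> indep_surface = {region_solution k \<mu> | k. region k \<mu>}"
    using argmin_region_optimum[OF \<mu>] region_correct[OF \<mu>]
    unfolding region_optimum_def region_correct_def by blast
next
  fix \<mu> :: "real ^ 4" and k assume "\<mu> \<in> prob_simplex" "region k \<mu>"
  then show "wasserstein_setdist L0_metric \<mu> indep_surface = region_distance k \<mu>"
    using region_correct by (simp add: region_correct_def)
next
  have "bias2 \<mu> = 0 \<and> det4 \<mu> \<le> 0 \<longleftrightarrow>
      \<mu>$2 - \<mu>$3 = 0 \<and> \<mu>$1 + \<mu>$2 \<ge> sqrt (\<mu>$1) \<and> \<mu>$1 + \<mu>$3 \<ge> sqrt (\<mu>$1)"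
    if "\<mu> \<in> prob_simplex" for \<mu>
    using wall_iff[of "\<mu>$1" "\<mu>$2" "\<mu>$4"] that
    by (cases "\<mu>$3 = \<mu>$2") (simp_all add: prob_simplex_4 bias2_def det4_def)
  moreover have "bias1 \<mu> = 0 \<and> 0 \<le> det4 \<mu> \<longleftrightarrow>
      \<mu>$1 - \<mu>$4 = 0 \<and> \<mu>$1 + \<mu>$2 \<ge> sqrt (\<mu>$2) \<and> \<mu>$2 + \<mu>$4 \<ge> sqrt (\<mu>$2)"
    if "\<mu> \<in> prob_simplex" for \<mu>
    using wall_iff[of "\<mu>$2" "\<mu>$1" "\<mu>$3"] that
    by (cases "\<mu>$4 = \<mu>$1") (simp_all add: prob_simplex_4 bias1_def det4_def add.commute)
  ultimately show "indecision_walls L0_metric indep_surface =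
          {\<mu> \<in> prob_simplex. \<mu>$2 - \<mu>$3 = 0 \<and> \<mu>$1 + \<mu>$2 \<ge> sqrt (\<mu>$1) \<and> \<mu>$1 + \<mu>$3 \<ge> sqrt (\<mu>$1)}
        \<union> {\<mu> \<in> prob_simplex. \<mu>$1 - \<mu>$4 = 0 \<and> \<mu>$1 + \<mu>$2 \<ge> sqrt (\<mu>$2) \<and> \<mu>$2 + \<mu>$4 \<ge> sqrt (\<mu>$2)}"
    using closure_ambiguous unfolding indecision_walls_def ambiguous_def by (simp cong: conj_cong)
qed

end
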